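(* Let $p$ be a prime. Suppose that $f\in\mathbb{F}_p[x_1,\dots,x_n]$ is homogeneous under some $\mathbb{N}$-grading such that $\sqrt{\operatorname{Jac}(f)}=(x_1,\dots,x_n)$ and $\deg f\ge\sum_{i=1}^n\deg x_i$. Then $\operatorname{fpt}(f)=\operatorname{fpt}(f+g)$ for each $g\in(x_1,\dots,x_n)^{\,n\deg f-\sum_{i=1}^n\deg x_i+1}$.
   Context: An $\mathbb{N}$-grading on a polynomial ring over a field is a grading in which field elements have degree $0$ and each variable has a positive integer degree. $\operatorname{Jac}(f)$ is the ideal generated by the partial derivatives of $f$. With $\mathfrak{m}=(x_1,\dots,x_n)$ and $\mathfrak{m}^{[p^e]}=(x_1^{p^e},\dots,x_n^{p^e})$, for a polynomial $h\in\mathfrak{m}$ set $\nu_h(p^e)=\max\{N:h^N\notin\mathfrak{m}^{[p^e]}\}$; the $F$-pure threshold of $h$ is $\operatorname{fpt}(h)=\lim_{e\to\infty}\nu_h(p^e)/p^e$ (the limit exists).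
   Formalization: The case n = 1 with deg x_1 = 1 is excluded: there f = c x^a with a ≥ 2 and p not dividing a, the exponent n deg f − deg x_1 + 1 equals a, and g = −f is allowed, giving fpt(f+g) = 0 ≠ 1/a = fpt(f), so the claim fails for every such f. *)

theory Defs
  imports Complex_Main "HOL-Library.Poly_Mapping" "HOL-Library.Cardinality" "HOL-Computational_Algebra.Primes"
begin

text \<open>Polynomials with coefficients in \<^typ>\<open>'k\<close> and one variable for each element of
  \<^typ>\<open>'n\<close>: finitely supported functions from exponent vectors to coefficients.\<close>

type_synonym ('n, 'k) mpoly = "('n \<Rightarrow>\<^sub>0 nat) \<Rightarrow>\<^sub>0 'k"

definition var :: "'n \<Rightarrow> ('n, 'k::comm_ring_1) mpoly" where
  "var i = Poly_Mapping.single (Poly_Mapping.single i 1) 1"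

text \<open>In a monomial free of \<open>X\<^sub>i\<close> the subtraction of exponents truncates, but the
  coefficient is then 0.\<close>

definition pdiff :: "'n \<Rightarrow> ('n, 'k::comm_ring_1) mpoly \<Rightarrow> ('n, 'k) mpoly" where
  "pdiff i f = (\<Sum>m\<in>Poly_Mapping.keys f.
     Poly_Mapping.single (m - Poly_Mapping.single i 1)
       (of_nat (Poly_Mapping.lookup m i) * Poly_Mapping.lookup f m))"

lemma lookup_pdiff:
  "Poly_Mapping.lookup (pdiff i f) m =
     of_nat (Suc (Poly_Mapping.lookup m i)) *
       Poly_Mapping.lookup f (m + Poly_Mapping.single i 1)"
proof -
  let ?e = "Poly_Mapping.single i (1::nat)"
  let ?c = "\<lambda>m'. of_nat (Poly_Mapping.lookup m' i) * Poly_Mapping.lookup f m'"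
  have eq: "(?c m' when m' - ?e = m) = (if m' = m + ?e then ?c (m + ?e) else 0)" for m'
  proof (cases "Poly_Mapping.lookup m' i = 0")
    case True
    then have "m' \<noteq> m + ?e"
      by (auto simp: lookup_add)
    with True show ?thesis by (simp add: when_def)
  next
    case False
    then have "m' - ?e + ?e = m'"
      by (intro poly_mapping_eqI) (auto simp: lookup_add lookup_minus lookup_single when_def)
    then have "m' - ?e = m \<longleftrightarrow> m' = m + ?e" by (metis add_diff_cancel_right')
    then show ?thesis by (auto simp: when_def)
  qed
  have "Poly_Mapping.lookup (pdiff i f) m =
      (\<Sum>m'\<in>Poly_Mapping.keys f. ?c m' when m' - ?e = m)"
    by (simp add: pdiff_def lookup_sum lookup_single)
  also have "\<dots> = (if m + ?e \<in> Poly_Mapping.keys f then ?c (m + ?e) else 0)"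
    unfolding eq by simp
  also have "\<dots> = ?c (m + ?e)"
    by (simp add: in_keys_iff)
  finally show ?thesis by (simp add: lookup_add)
qed

text \<open>The ideal generated by a set is its span over the ring itself, written \<open>ideal.span\<close>.\<close>

interpretation ideal: module "(*) :: 'a::comm_ring_1 \<Rightarrow> 'a \<Rightarrow> 'a"
  by standard (simp_all add: algebra_simps)

primrec ideal_power :: "'a::comm_ring_1 set \<Rightarrow> nat \<Rightarrow> 'a set" where
  "ideal_power I 0 = UNIV"
| "ideal_power I (Suc k) = ideal.span {a * b | a b. a \<in> I \<and> b \<in> ideal_power I k}"

definition ideal_radical :: "'a::comm_ring_1 set \<Rightarrow> 'a set" where
  "ideal_radical I = {x. \<exists>k. x ^ k \<in> I}"

definition Jac :: "('n, 'k::comm_ring_1) mpoly \<Rightarrow> ('n, 'k) mpoly set" where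
  "Jac f = ideal.span (range (\<lambda>i. pdiff i f))"

definition max_ideal :: "('n, 'k::comm_ring_1) mpoly set" where
  "max_ideal = ideal.span (range var)"

definition max_ideal_frob :: "nat \<Rightarrow> ('n, 'k::comm_ring_1) mpoly set" where
  "max_ideal_frob q = ideal.span (range (\<lambda>i. var i ^ q))"

text \<open>A grading in which the variables have positive degrees \<open>w\<close>; the zero polynomial is
  homogeneous of every degree.\<close>

definition homogeneous ::
    "('n::finite \<Rightarrow> nat) \<Rightarrow> nat \<Rightarrow> ('n, 'k::comm_ring_1) mpoly \<Rightarrow> bool" where
  "homogeneous w d f \<longleftrightarrow>
     (\<forall>m\<in>Poly_Mapping.keys f. (\<Sum>i\<in>UNIV. w i * Poly_Mapping.lookup m i) = d)"

text \<open>Meaningful for \<open>h \<in> max_ideal\<close> and \<open>q > 0\<close>: the set is then finite and contains 0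
  (in particular \<open>\<nu> 0 q = 0\<close>).\<close>

definition \<nu> :: "('n::finite, 'k::field) mpoly \<Rightarrow> nat \<Rightarrow> nat" where
  "\<nu> h q = Max {N. h ^ N \<notin> max_ideal_frob q}"

definition fpt :: "nat \<Rightarrow> ('n::finite, 'k::field) mpoly \<Rightarrow> real" where
  "fpt p h = lim (\<lambda>e. real (\<nu> h (p ^ e)) / real (p ^ e))"

end

theory Submission
  imports Defs "HOL-Number_Theory.Residues"
begin

text \<open>
  Write \<open>\<mm>\<close> for the ideal of the variables, \<open>|w|\<close> for the sum of their degrees and \<open>\<theta>\<^sub>j\<close> for the
  partial derivatives of \<open>f\<close>.  The two thresholds agree because \<open>f\<close> and \<open>f + g\<close> have the same
  function \<open>\<nu>\<close>: for every \<open>q = p ^ e\<close> and every \<open>N\<close>, \<open>f ^ N\<close> lies in the Frobenius power of \<open>\<mm>\<close>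
  for \<open>q\<close> if and only if \<open>(f + g) ^ N\<close> does.  No limit has to be computed.

  One direction is about initial forms: the monomials of \<open>g\<close> have weighted degree above \<open>d\<close>, so
  \<open>f ^ N\<close> is the initial form of \<open>(f + g) ^ N\<close>, and the Frobenius power is a monomial ideal
  (\<open>initial_form_power_mem_max_ideal_frob\<close>).

  For the converse let \<open>N\<close> be least with \<open>f ^ N\<close> in the Frobenius power for \<open>q\<close>.  If \<open>p\<close> divides
  \<open>N\<close>, flatness of Frobenius lowers both \<open>N\<close> and \<open>q\<close> by a factor \<open>p\<close>, and induction on \<open>e\<close>
  applies.  Otherwise, differentiating \<open>f ^ N\<close> shows that \<open>f ^ (N - 1)\<close>, which is not in the
  Frobenius power, multiplies the Jacobian ideal into it.  The Jacobian ideal contains all monomials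
  of degree larger than the sum \<open>n d - |w|\<close> of the degrees of the \<open>\<theta>\<^sub>j\<close> (\<open>mem_of_large_order\<close>), so
  monomial duality forces \<open>f ^ (N - 1)\<close> to have degree at least \<open>(q - 1) |w| - (n d - |w|)\<close>
  (\<open>homogeneous_power_degree_bound\<close>).  Every term of \<open>(f + g) ^ N - f ^ N\<close> contains \<open>g\<close>, hence
  exceeds the degree of \<open>f ^ (N - 1)\<close> by more than \<open>n d - |w|\<close>; its degree is above
  \<open>(q - 1) |w|\<close>, and all such monomials lie in the Frobenius power.

  That the Jacobian ideal contains all monomials \<open>u\<close> of degree above \<open>n d - |w|\<close> is shown by a
  tight closure argument: the powers \<open>u ^ Q\<close>, expanded over the subalgebra generated by the
  \<open>\<theta>\<^sub>j\<close>, lie in the ideal of the \<open>\<theta>\<^sub>j ^ Q\<close> as soon as \<open>Q\<close> is a large power of \<open>p\<close>, and flatness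
  of Frobenius brings \<open>u\<close> back into the ideal of the \<open>\<theta>\<^sub>j\<close>.
\<close>

section \<open>Monomials, ideals of finite families and Frobenius powers\<close>

abbreviation "lookup \<equiv> Poly_Mapping.lookup"
abbreviation "keys \<equiv> Poly_Mapping.keys"
abbreviation "single \<equiv> Poly_Mapping.single"

lemma sum_single_lookup:
  fixes h :: "'a \<Rightarrow>\<^sub>0 'b::comm_monoid_add"
  shows "(\<Sum>m\<in>keys h. single m (lookup h m)) = h"
proof (rule poly_mapping_eqI)
  fix k
  have "lookup (\<Sum>m\<in>keys h. single m (lookup h m)) k = (\<Sum>m\<in>keys h. if m = k then lookup h k else 0)"
    unfolding lookup_sum by (intro sum.cong) (auto simp: lookup_single when_def)
  also have "\<dots> = lookup h k" by (simp add: in_keys_iff)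
  finally show "lookup (\<Sum>m\<in>keys h. single m (lookup h m)) k = lookup h k" .
qed

lemma poly_mapping_sum_induct [case_names zero single add]:
  fixes h :: "'a \<Rightarrow>\<^sub>0 'b::comm_monoid_add"
  assumes "P 0" and "\<And>m c. P (single m c)" and "\<And>a b. P a \<Longrightarrow> P b \<Longrightarrow> P (a + b)"
  shows "P h"
proof -
  have "P (\<Sum>m\<in>A. single m (lookup h m))" if "finite A" for A
    using that by induction (auto intro: assms)
  from this[of "keys h"] show ?thesis by (simp add: sum_single_lookup)
qed

lemma lookup_single_mult_add:
  fixes h :: "'a::cancel_comm_monoid_add \<Rightarrow>\<^sub>0 'b::comm_semiring_0"
  shows "lookup (single a c * h) (a + m) = c * lookup h m"
  by (induction h rule: poly_mapping_sum_induct)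
     (auto simp: mult_single lookup_single when_def lookup_add distrib_left)

lemma var_power: "var i ^ q = single (single i q) 1"
proof (induction q)
  case 0
  show ?case by (simp flip: single_one)
next
  case (Suc q)
  then show ?case by (simp add: var_def mult_single flip: single_add)
qed

lemma ideal_span_range_iff:
  fixes a :: "'i::finite \<Rightarrow> 'a::comm_ring_1"
  shows "x \<in> ideal.span (range a) \<longleftrightarrow> (\<exists>c. x = (\<Sum>i\<in>UNIV. c i * a i))"
proof
  assume "x \<in> ideal.span (range a)"
  then show "\<exists>c. x = (\<Sum>i\<in>UNIV. c i * a i)"
  proof (induction rule: ideal.span_induct_alt)
    case base
    show ?case by (intro exI[of _ "\<lambda>_. 0"]) simp
  next
    case (step r y z)
    then obtain j c where "y = a j" "z = (\<Sum>i\<in>UNIV. c i * a i)" by blast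
    then have "r * y + z = (\<Sum>i\<in>UNIV. ((if i = j then r else 0) + c i) * a i)"
      by (simp add: distrib_right sum.distrib if_distrib[of "\<lambda>x. x * _"] cong: if_cong)
    then show ?case by (rule exI[of _ "\<lambda>i. (if i = j then r else 0) + c i"])
  qed
next
  assume "\<exists>c. x = (\<Sum>i\<in>UNIV. c i * a i)"
  then obtain c where x: "x = (\<Sum>i\<in>UNIV. c i * a i)" ..
  show "x \<in> ideal.span (range a)"
    unfolding x by (intro ideal.span_sum ideal.span_scale ideal.span_base rangeI)
qed

text \<open>A monomial ideal contains a polynomial exactly if it contains each of its monomials, so that
  membership can be read off from the exponents.\<close>

lemma max_ideal_frob_iff:
  fixes h :: "('n, 'k::comm_ring_1) mpoly"
  shows "h \<in> max_ideal_frob q \<longleftrightarrow> (\<forall>m\<in>keys h. \<exists>i. q \<le> lookup m i)"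
proof
  assume "h \<in> max_ideal_frob q"
  then show "\<forall>m\<in>keys h. \<exists>i. q \<le> lookup m i"
    unfolding max_ideal_frob_def
  proof (induction rule: ideal.span_induct_alt)
    case base
    show ?case by simp
  next
    case (step r y z)
    then obtain j where y: "y = single (single j q) 1" by (auto simp: var_power)
    show ?case
    proof
      fix m assume "m \<in> keys (r * y + z)"
      then consider "m \<in> keys (r * y)" | "m \<in> keys z" using keys_add[of "r * y" z] by blast
      then show "\<exists>i. q \<le> lookup m i"
      proof cases
        case 1
        then obtain b where "m = b + single j q"
          using keys_mult[of r y] by (auto simp: y split: if_splits)
        then have "q \<le> lookup m j" by (simp add: lookup_add)
        then show ?thesis ..
      qed (use step in blast)
    qed
  qed
next
  assume *: "\<forall>m\<in>keys h. \<exists>i. q \<le> lookup m i"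
  have "(\<Sum>m\<in>keys h. single m (lookup h m)) \<in> max_ideal_frob q"
    unfolding max_ideal_frob_def
  proof (rule ideal.span_sum)
    fix m assume "m \<in> keys h"
    with * obtain i where i: "q \<le> lookup m i" by blast
    then have "m = (m - single i q) + single i q"
      by (intro poly_mapping_eqI) (auto simp: lookup_add lookup_minus lookup_single when_def)
    then have "single m (lookup h m) = single (m - single i q) (lookup h m) * var i ^ q"
      by (simp add: var_power mult_single)
    then show "single m (lookup h m) \<in> ideal.span (range (\<lambda>i. var i ^ q))"
      by (auto intro: ideal.span_scale ideal.span_base)
  qed
  then show "h \<in> max_ideal_frob q" by (simp add: sum_single_lookup)
qed

lemma max_ideal_eq_frob_1: "max_ideal = max_ideal_frob 1"
  by (simp add: max_ideal_def max_ideal_frob_def)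

section \<open>Weighted order\<close>

definition wdeg :: "('n::finite \<Rightarrow> nat) \<Rightarrow> ('n \<Rightarrow>\<^sub>0 nat) \<Rightarrow> nat" where
  "wdeg w m = (\<Sum>i\<in>UNIV. w i * lookup m i)"

definition order_ge :: "('n::finite \<Rightarrow> nat) \<Rightarrow> nat \<Rightarrow> ('n, 'k::comm_ring_1) mpoly \<Rightarrow> bool" where
  "order_ge w t h \<longleftrightarrow> (\<forall>m\<in>keys h. t \<le> wdeg w m)"

lemma homogeneous_iff_wdeg: "homogeneous w d f \<longleftrightarrow> (\<forall>m\<in>keys f. wdeg w m = d)"
  by (simp add: homogeneous_def wdeg_def)

lemma wdeg_add: "wdeg w (a + b) = wdeg w a + wdeg w b"
  by (simp add: wdeg_def lookup_add distrib_left sum.distrib)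

lemma wdeg_zero [simp]: "wdeg w 0 = 0"
  by (simp add: wdeg_def)

lemma wdeg_single [simp]: "wdeg w (single i k) = w i * k"
  by (simp add: wdeg_def lookup_single when_def if_distrib cong: if_cong)

lemma order_ge_zero_poly [simp]: "order_ge w t 0"
  by (simp add: order_ge_def)

lemma order_ge_0 [simp]: "order_ge w 0 h"
  by (simp add: order_ge_def)

lemma order_ge_mono: "order_ge w t h \<Longrightarrow> s \<le> t \<Longrightarrow> order_ge w s h"
  by (force simp: order_ge_def)

lemma order_ge_add: "order_ge w t a \<Longrightarrow> order_ge w t b \<Longrightarrow> order_ge w t (a + b)"
  using keys_add[of a b] by (auto simp: order_ge_def)

lemma order_ge_diff: "order_ge w t a \<Longrightarrow> order_ge w t b \<Longrightarrow> order_ge w t (a - b)"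
  by (force simp: order_ge_def in_keys_iff lookup_minus)

lemma order_ge_sum: "(\<And>i. i \<in> A \<Longrightarrow> order_ge w t (h i)) \<Longrightarrow> order_ge w t (\<Sum>i\<in>A. h i)"
  by (induction A rule: infinite_finite_induct) (auto intro: order_ge_add)

lemma order_ge_mult: "order_ge w s a \<Longrightarrow> order_ge w t b \<Longrightarrow> order_ge w (s + t) (a * b)"
  using keys_mult[of a b] by (fastforce simp: order_ge_def wdeg_add add_mono)

lemma order_ge_power: "order_ge w t h \<Longrightarrow> order_ge w (N * t) (h ^ N)"
  by (induction N) (auto intro: order_ge_mult)

lemma homogeneous_imp_order_ge: "homogeneous w d f \<Longrightarrow> order_ge w d f"
  by (simp add: homogeneous_iff_wdeg order_ge_def)

lemma homogeneous_mult:
  "homogeneous w s a \<Longrightarrow> homogeneous w t b \<Longrightarrow> homogeneous w (s + t) (a * b)"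
  using keys_mult[of a b] by (fastforce simp: homogeneous_iff_wdeg wdeg_add)

lemma homogeneous_power: "homogeneous w d f \<Longrightarrow> homogeneous w (N * d) (f ^ N)"
proof (induction N)
  case 0
  show ?case by (simp add: homogeneous_iff_wdeg)
next
  case (Suc N)
  then show ?case using homogeneous_mult[of w d f "N * d" "f ^ N"] by simp
qed

text \<open>The weights are all 1 here: a generator of the \<open>k\<close>-th power is a product of \<open>k\<close> polynomials
  without constant term.\<close>

lemma order_ge_ideal_power_max_ideal:
  assumes "h \<in> ideal_power max_ideal k"
  shows "order_ge (\<lambda>_. 1) k h"
  using assms
proof (induction k arbitrary: h)
  case 0
  show ?case by simp
next
  case (Suc k)
  have var: "order_ge (\<lambda>_. 1) 1 a" if "a \<in> max_ideal" for a :: "('a, 'b) mpoly"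
    unfolding order_ge_def
  proof
    fix m assume "m \<in> keys a"
    with that obtain i where "1 \<le> lookup m i"
      by (auto simp: max_ideal_eq_frob_1 max_ideal_frob_iff)
    also have "lookup m i \<le> wdeg (\<lambda>_. 1) m"
      by (simp add: wdeg_def member_le_sum)
    finally show "1 \<le> wdeg (\<lambda>_. 1) m" .
  qed
  from Suc.prems have "h \<in> ideal.span {a * b | a b. a \<in> max_ideal \<and> b \<in> ideal_power max_ideal k}"
    by simp
  then show ?case
  proof (induction rule: ideal.span_induct_alt)
    case (step r y z)
    then obtain a b where y: "y = a * b" and ab: "a \<in> max_ideal" "b \<in> ideal_power max_ideal k"
      by blast
    have "order_ge (\<lambda>_. 1) (0 + (1 + k)) (r * (a * b))"
      using var[OF ab(1)] Suc.IH[OF ab(2)] by (intro order_ge_mult order_ge_0)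
    with step show ?case by (auto simp: y intro: order_ge_add)
  qed simp
qed

text \<open>Pigeonhole: a monomial whose exponents are all at most \<open>q - 1\<close> has weighted degree at most
  \<open>q - 1\<close> times the sum of the weights.\<close>

lemma max_ideal_frob_of_order:
  assumes "order_ge w t h" and "(q - 1) * (\<Sum>i\<in>UNIV. w i) < t"
  shows "h \<in> max_ideal_frob q"
  unfolding max_ideal_frob_iff
proof
  fix m assume "m \<in> keys h"
  then have m: "t \<le> wdeg w m" using assms by (simp add: order_ge_def)
  show "\<exists>i. q \<le> lookup m i"
  proof (rule ccontr)
    assume "\<nexists>i. q \<le> lookup m i"
    then have "lookup m i < q" for i by (simp add: not_le)
    then have "lookup m i \<le> q - 1" for i using less_imp_Suc_add[of "lookup m i" q] by auto
    then have "wdeg w m \<le> (\<Sum>i\<in>UNIV. w i * (q - 1))"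
      unfolding wdeg_def by (intro sum_mono mult_left_mono) auto
    also have "\<dots> = (q - 1) * (\<Sum>i\<in>UNIV. w i)"
      by (metis mult.commute sum_distrib_right)
    finally show False using m assms(2) by simp
  qed
qed

lemma split_by_wdeg:
  fixes h :: "('n::finite, 'k::comm_ring_1) mpoly"
  obtains a b where "h = a + b" "order_ge w s a" "\<And>m. m \<in> keys b \<Longrightarrow> wdeg w m < s"
proof
  let ?a = "\<Sum>m\<in>{m\<in>keys h. s \<le> wdeg w m}. single m (lookup h m)"
  let ?b = "\<Sum>m\<in>{m\<in>keys h. \<not> s \<le> wdeg w m}. single m (lookup h m)"
  have "h = (\<Sum>m\<in>{m\<in>keys h. s \<le> wdeg w m} \<union> {m\<in>keys h. \<not> s \<le> wdeg w m}. single m (lookup h m))"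
    by (subst sum_single_lookup[of h, symmetric], rule sum.cong) auto
  also have "\<dots> = ?a + ?b" by (rule sum.union_disjoint) auto
  finally show "h = ?a + ?b" .
  show "order_ge w s ?a" by (rule order_ge_sum) (auto simp: order_ge_def)
  fix m assume "m \<in> keys ?b"
  then show "wdeg w m < s"
    using keys_sum[of "\<lambda>m. single m (lookup h m)" "{m\<in>keys h. \<not> s \<le> wdeg w m}"]
    by (fastforce split: if_splits)
qed

text \<open>The parts of the cofactors of degree below \<open>t - \<delta> j\<close> only produce terms of degree below \<open>t\<close>,
  because the generators are homogeneous.  As \<open>h\<close> has no such terms, these parts cancel and can be
  dropped.\<close>

lemma order_ge_cofactors:
  fixes \<theta> :: "'i::finite \<Rightarrow> ('n::finite, 'k::comm_ring_1) mpoly"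
  assumes hom: "\<And>j. homogeneous w (\<delta> j) (\<theta> j)"
    and "order_ge w t h" and "h \<in> ideal.span (range \<theta>)"
  obtains c where "h = (\<Sum>j\<in>UNIV. c j * \<theta> j)" "\<And>j. order_ge w (t - \<delta> j) (c j)"
proof -
  obtain c where c: "h = (\<Sum>j\<in>UNIV. c j * \<theta> j)"
    using assms(3) by (auto simp: ideal_span_range_iff)
  have "\<exists>a b. c j = a + b \<and> order_ge w (t - \<delta> j) a \<and> (\<forall>m\<in>keys b. wdeg w m < t - \<delta> j)" for j
    using split_by_wdeg[of "c j" w "t - \<delta> j"] by metis
  then obtain a b where ab: "\<And>j. c j = a j + b j" "\<And>j. order_ge w (t - \<delta> j) (a j)"
      "\<And>j m. m \<in> keys (b j) \<Longrightarrow> wdeg w m < t - \<delta> j"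
    by metis
  have low: "wdeg w m < t" if m: "m \<in> keys (\<Sum>j\<in>UNIV. b j * \<theta> j)" for m
  proof -
    obtain j where "m \<in> keys (b j * \<theta> j)"
      using m keys_sum[of "\<lambda>j. b j * \<theta> j" UNIV] by blast
    then obtain x y where "m = x + y" "x \<in> keys (b j)" "y \<in> keys (\<theta> j)"
      using keys_mult by blast
    then show ?thesis using ab(3)[of x j] hom[of j]
      by (auto simp: homogeneous_iff_wdeg wdeg_add)
  qed
  have "order_ge w t (a j * \<theta> j)" for j
    using order_ge_mult[OF ab(2)[of j] homogeneous_imp_order_ge[OF hom[of j]]]
    by (rule order_ge_mono) simp
  then have "order_ge w t (h - (\<Sum>j\<in>UNIV. a j * \<theta> j))"
    using assms(2) by (intro order_ge_diff order_ge_sum)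
  moreover have "h - (\<Sum>j\<in>UNIV. a j * \<theta> j) = (\<Sum>j\<in>UNIV. b j * \<theta> j)"
    by (simp add: c ab(1) distrib_right sum.distrib)
  ultimately have "keys (\<Sum>j\<in>UNIV. b j * \<theta> j) = {}"
    using low by (metis order_ge_def all_not_in_conv not_le)
  then have "(\<Sum>j\<in>UNIV. b j * \<theta> j) = 0" by simp
  then have "h = (\<Sum>j\<in>UNIV. a j * \<theta> j)"
    by (simp add: c ab(1) distrib_right sum.distrib)
  then show thesis using ab(2) that by blast
qed

section \<open>The Cartier operator\<close>

definition exp_scale :: "nat \<Rightarrow> ('n \<Rightarrow>\<^sub>0 nat) \<Rightarrow> ('n \<Rightarrow>\<^sub>0 nat)" where
  "exp_scale p m = Poly_Mapping.map ((*) p) m"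

text \<open>The splitting of Frobenius that keeps the monomials with all exponents divisible by \<open>p\<close> and
  takes their \<open>p\<close>-th roots.  Coefficients are left alone, which is right over the prime field, where
  every element is its own \<open>p\<close>-th root.\<close>

definition cartier :: "nat \<Rightarrow> ('n, 'k::comm_ring_1) mpoly \<Rightarrow> ('n, 'k) mpoly" where
  "cartier p h = Poly_Mapping.map_key (exp_scale p) h"

lemma lookup_exp_scale [simp]: "lookup (exp_scale p m) i = p * lookup m i"
  by (simp add: exp_scale_def Poly_Mapping.map.rep_eq when_def)

lemma exp_scale_add: "exp_scale p (a + b) = exp_scale p a + exp_scale p b"
  by (intro poly_mapping_eqI) (simp add: lookup_add distrib_left)

lemma inj_exp_scale: "p > 0 \<Longrightarrow> inj (exp_scale p)"
  by (rule injI) (simp add: poly_mapping_eq_iff fun_eq_iff)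

lemma lookup_cartier: "p > 0 \<Longrightarrow> lookup (cartier p h) m = lookup h (exp_scale p m)"
  by (simp add: cartier_def inj_exp_scale Poly_Mapping.map_key.rep_eq)

lemma cartier_zero: "p > 0 \<Longrightarrow> cartier p 0 = 0"
  by (rule poly_mapping_eqI) (simp add: lookup_cartier)

lemma cartier_add: "p > 0 \<Longrightarrow> cartier p (a + b) = cartier p a + cartier p b"
  by (rule poly_mapping_eqI) (simp add: lookup_cartier lookup_add)

lemma cartier_sum: "p > 0 \<Longrightarrow> cartier p (\<Sum>i\<in>A. h i) = (\<Sum>i\<in>A. cartier p (h i))"
  by (rule poly_mapping_eqI) (simp add: lookup_cartier lookup_sum)

lemma cartier_one: "p > 0 \<Longrightarrow> cartier p 1 = (1 :: ('n, 'k::comm_ring_1) mpoly)"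
proof (rule poly_mapping_eqI)
  fix m :: "'n \<Rightarrow>\<^sub>0 nat" assume "p > 0"
  then have "exp_scale p m = 0 \<longleftrightarrow> m = 0"
    by (auto simp: poly_mapping_eq_iff fun_eq_iff)
  then show "lookup (cartier p 1) m = lookup (1 :: ('n, 'k) mpoly) m"
    using \<open>p > 0\<close> by (simp add: lookup_cartier lookup_one)
qed

lemma cartier_single_scaled_mult:
  fixes h :: "('n, 'k::comm_ring_1) mpoly"
  assumes p: "p > 0"
  shows "cartier p (single (exp_scale p a) c * h) = single a c * cartier p h"
proof (induction h rule: poly_mapping_sum_induct)
  case zero
  show ?case by (simp add: cartier_zero p)
next
  case (single m v)
  show ?case
  proof (cases "m \<in> range (exp_scale p)")
    case True
    then obtain b where b: "m = exp_scale p b" by blast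
    have "cartier p (single (exp_scale p x) v') = single x v'" for x :: "'n \<Rightarrow>\<^sub>0 nat" and v' :: 'k
      by (simp add: cartier_def map_key_single[OF inj_exp_scale[OF p]])
    then show ?thesis by (simp add: b mult_single flip: exp_scale_add)
  next
    case False
    have "exp_scale p a + m \<noteq> exp_scale p k" for k
    proof
      assume eq: "exp_scale p a + m = exp_scale p k"
      have "m = exp_scale p (k - a)"
      proof (rule poly_mapping_eqI)
        fix i
        have "p * lookup a i + lookup m i = p * lookup k i"
          using arg_cong[OF eq, of "\<lambda>z. lookup z i"] by (simp add: lookup_add)
        then show "lookup m i = lookup (exp_scale p (k - a)) i"
          by (simp add: lookup_minus diff_mult_distrib2)
      qed
      with False show False by blast
    qed
    then have "cartier p (single (exp_scale p a + m) (c * v)) = 0"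
      by (intro poly_mapping_eqI) (simp add: lookup_cartier p lookup_single when_def)
    moreover have "cartier p (single m v) = 0"
      using False by (intro poly_mapping_eqI) (auto simp: lookup_cartier p lookup_single when_def)
    ultimately show ?thesis by (simp add: mult_single)
  qed
next
  case (add a b)
  then show ?case by (simp add: distrib_left cartier_add p)
qed

lemma single_power: "single m c ^ N = single (exp_scale N m) (c ^ N)"
proof (induction N)
  case 0
  have "exp_scale 0 m = 0" by (rule poly_mapping_eqI) simp
  then show ?case by (simp flip: single_one)
next
  case (Suc N)
  have "exp_scale (Suc N) m = m + exp_scale N m"
    by (rule poly_mapping_eqI) (simp add: lookup_add)
  with Suc show ?case by (simp add: mult_single)
qed

lemma CHAR_eq_prime_CARD:
  assumes "prime p" "CARD('k::{finite,field}) = p"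
  shows "CHAR('k) = p"
proof -
  have "CHAR('k) dvd p" using CHAR_dvd_CARD[where 'a = 'k] assms(2) by simp
  then have "CHAR('k) = 1 \<or> CHAR('k) = p" using assms(1) unfolding prime_nat_iff by blast
  then show ?thesis using CHAR_not_1'[where 'a = 'k] by simp
qed

lemma CHAR_mpoly:
  "CHAR(('n, 'k::comm_ring_1) mpoly) = CHAR('k)"
proof (rule CHAR_eqI)
  have iff: "of_nat n = (0 :: ('n, 'k) mpoly) \<longleftrightarrow> CHAR('k) dvd n" for n
  proof
    assume "of_nat n = (0 :: ('n, 'k) mpoly)"
    then have "lookup (of_nat n :: ('n, 'k) mpoly) 0 = 0" by simp
    then show "CHAR('k) dvd n" by (simp add: lookup_of_nat of_nat_eq_0_iff_char_dvd)
  next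
    assume "CHAR('k) dvd n"
    then have "(of_nat n :: 'k) = 0" by (simp add: of_nat_eq_0_iff_char_dvd)
    then show "of_nat n = (0 :: ('n, 'k) mpoly)"
      by (intro poly_mapping_eqI) (simp add: lookup_of_nat when_def)
  qed
  show "of_nat CHAR('k) = (0 :: ('n, 'k) mpoly)"
    by (simp only: iff dvd_refl)
  show "CHAR('k) dvd n" if "of_nat n = (0 :: ('n, 'k) mpoly)" for n
    using that by (simp only: iff)
qed

lemma frobenius_add:
  fixes a b :: "('n, 'k::{finite,field}) mpoly"
  assumes p: "prime p" and k: "CARD('k) = p"
  shows "(a + b) ^ p = a ^ p + b ^ p"
  by (rule freshmans_dream) (simp_all add: CHAR_mpoly CHAR_eq_prime_CARD[OF p k] p)

lemma frobenius_sum: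
  fixes a :: "'i \<Rightarrow> ('n, 'k::{finite,field}) mpoly"
  assumes p: "prime p" and k: "CARD('k) = p"
  shows "(\<Sum>i\<in>A. a i) ^ p = (\<Sum>i\<in>A. a i ^ p)"
  by (rule freshmans_dream_sum) (simp_all add: CHAR_mpoly CHAR_eq_prime_CARD[OF p k] p)

text \<open>A field with \<open>p\<close> elements consists of the images of natural numbers, and on these the claim
  follows by induction from the additivity of Frobenius.\<close>

lemma prime_field_power_eq_same:
  fixes c :: "'k::{finite,field}"
  assumes p: "prime p" and k: "CARD('k) = p"
  shows "c ^ p = c"
proof -
  note char = CHAR_eq_prime_CARD[OF p k]
  have "inj_on (of_nat :: nat \<Rightarrow> 'k) {..<p}"
  proof (rule linorder_inj_onI)
    fix x y :: nat assume "x < y" "x \<in> {..<p}" "y \<in> {..<p}"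
    then have "\<not> p dvd y - x" by (auto dest!: dvd_imp_le)
    then have "of_nat (y - x) \<noteq> (0 :: 'k)" by (simp add: of_nat_eq_0_iff_char_dvd char)
    then show "of_nat x \<noteq> (of_nat y :: 'k)" using \<open>x < y\<close> by (simp add: of_nat_diff)
  qed auto
  then have "card (of_nat ` {..<p} :: 'k set) = CARD('k)" by (simp add: card_image k)
  then have "of_nat ` {..<p} = (UNIV :: 'k set)" by (intro card_subset_eq) auto
  then obtain n where n: "c = of_nat n" by (metis UNIV_I imageE)
  have "(of_nat n :: 'k) ^ p = of_nat n"
  proof (induction n)
    case (Suc n)
    have "(1 + of_nat n :: 'k) ^ p = 1 ^ p + of_nat n ^ p"
      by (rule freshmans_dream) (simp_all add: char p)
    with Suc show ?case by simp
  qed (use p in \<open>simp add: zero_power prime_gt_0_nat\<close>)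
  then show ?thesis by (simp add: n)
qed

text \<open>Linearity over the subring of \<open>p\<close>-th powers.  Both sides are additive in \<open>g\<close>, which reduces the
  claim to terms \<open>c x\<^sup>m\<close>, where \<open>c ^ p = c\<close>.\<close>

lemma cartier_power_mult:
  fixes g h :: "('n, 'k::{finite,field}) mpoly"
  assumes p: "prime p" and k: "CARD('k) = p"
  shows "cartier p (g ^ p * h) = g * cartier p h"
proof (induction g rule: poly_mapping_sum_induct)
  case zero
  have "p > 0" using p by (simp add: prime_gt_0_nat)
  then show ?case by (simp add: zero_power cartier_zero)
next
  case (single m c)
  have "c ^ p = c" by (rule prime_field_power_eq_same[OF p k])
  then show ?case
    using p by (simp add: single_power cartier_single_scaled_mult prime_gt_0_nat)
next
  case (add a b)
  then show ?case
    using p by (simp add: frobenius_add[OF p k] distrib_right cartier_add prime_gt_0_nat)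
qed

text \<open>Flatness of Frobenius, in the form that the contraction of a Frobenius power of an ideal is the
  ideal itself: applying the Cartier operator to an expression of \<open>u ^ p\<close> through the \<open>a\<^sub>i ^ p\<close>
  yields one of \<open>u\<close> through the \<open>a\<^sub>i\<close>.\<close>

lemma ideal_frobenius_iff:
  fixes a :: "'i::finite \<Rightarrow> ('n, 'k::{finite,field}) mpoly"
  assumes p: "prime p" and k: "CARD('k) = p"
  shows "u ^ p \<in> ideal.span (range (\<lambda>i. a i ^ p)) \<longleftrightarrow> u \<in> ideal.span (range a)"
proof
  assume "u ^ p \<in> ideal.span (range (\<lambda>i. a i ^ p))"
  then obtain c where c: "u ^ p = (\<Sum>i\<in>UNIV. c i * a i ^ p)"
    by (auto simp: ideal_span_range_iff)
  have "p > 0" using p by (simp add: prime_gt_0_nat)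
  have "u = cartier p (u ^ p * 1)"
    using cartier_power_mult[OF p k, of u 1] cartier_one[OF \<open>p > 0\<close>, where 'n = 'n and 'k = 'k] by simp
  also have "\<dots> = (\<Sum>i\<in>UNIV. cartier p (c i) * a i)"
  proof -
    have "cartier p (c i * a i ^ p) = cartier p (c i) * a i" for i
      using cartier_power_mult[OF p k, of "a i" "c i"] by (simp only: mult.commute)
    then show ?thesis using \<open>p > 0\<close> by (simp add: c cartier_sum)
  qed
  finally show "u \<in> ideal.span (range a)" by (auto simp: ideal_span_range_iff)
next
  assume "u \<in> ideal.span (range a)"
  then obtain c where "u = (\<Sum>i\<in>UNIV. c i * a i)"
    by (auto simp: ideal_span_range_iff)
  then have "u ^ p = (\<Sum>i\<in>UNIV. c i ^ p * a i ^ p)"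
    by (simp add: frobenius_sum[OF p k] power_mult_distrib)
  then show "u ^ p \<in> ideal.span (range (\<lambda>i. a i ^ p))"
    by (auto simp: ideal_span_range_iff)
qed

lemma ideal_frobenius_power_iff:
  fixes a :: "'i::finite \<Rightarrow> ('n, 'k::{finite,field}) mpoly"
  assumes p: "prime p" and k: "CARD('k) = p"
  shows "u ^ (p ^ e) \<in> ideal.span (range (\<lambda>i. a i ^ (p ^ e))) \<longleftrightarrow> u \<in> ideal.span (range a)"
proof (induction e)
  case (Suc e)
  then show ?case
    using ideal_frobenius_iff[OF p k, of "u ^ (p ^ e)" "\<lambda>i. a i ^ (p ^ e)"]
    by (simp add: mult.commute flip: power_mult)
qed simp

lemma max_ideal_frob_power_iff:
  fixes u :: "('n::finite, 'k::{finite,field}) mpoly"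
  assumes p: "prime p" and k: "CARD('k) = p"
  shows "u ^ p \<in> max_ideal_frob (p * q) \<longleftrightarrow> u \<in> max_ideal_frob q"
  using ideal_frobenius_iff[OF p k, of u "\<lambda>i. var i ^ q"]
  by (simp add: max_ideal_frob_def mult.commute flip: power_mult)

section \<open>Polynomials of large order lie in a primary ideal\<close>

text \<open>Once all polynomials of order at least \<open>E\<close> lie in the ideal of the \<open>\<theta>\<^sub>j\<close>, a polynomial \<open>h\<close> of
  large order can be expanded repeatedly: \<open>h\<close> is a combination of the \<open>\<theta>\<^sub>j\<close>, the cofactors are
  combinations again, and so on until their order drops below \<open>E\<close>.  By then the products of the
  \<open>\<theta>\<^sub>j\<close> that have been split off carry all of the degree except for \<open>E\<close>.\<close>

lemma order_ge_imp_mem_span_products: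
  fixes \<theta> :: "'i::finite \<Rightarrow> ('n::finite, 'k::comm_ring_1) mpoly"
  assumes hom: "\<And>j. homogeneous w (\<delta> j) (\<theta> j)" and pos: "\<And>j. \<delta> j > 0"
    and E: "\<And>h. order_ge w E h \<Longrightarrow> h \<in> ideal.span (range \<theta>)"
    and "order_ge w (t + E) h"
  shows "h \<in> ideal.span {(\<Prod>j\<in>UNIV. \<theta> j ^ \<alpha> j) | \<alpha>. t \<le> (\<Sum>j\<in>UNIV. \<alpha> j * \<delta> j)}"
    (is "h \<in> ideal.span (?B t)")
  using assms(4)
proof (induction t arbitrary: h rule: less_induct)
  case (less t)
  \<comment> \<open>The empty product 1 is among the generators for the bound 0.\<close>
  have all: "x \<in> ideal.span (?B 0)" for x
  proof -
    have "1 \<in> ?B 0" by (simp, rule exI[of _ "\<lambda>_. 0"], simp)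
    then have "1 \<in> ideal.span (?B 0)" by (rule ideal.span_base)
    then have "x * 1 \<in> ideal.span (?B 0)" by (rule ideal.span_scale)
    then show ?thesis by simp
  qed
  show ?case
  proof (cases "t = 0")
    case True
    then show ?thesis using all by simp
  next
    case False
    from less.prems have "order_ge w E h" by (rule order_ge_mono) simp
    then have "h \<in> ideal.span (range \<theta>)" by (rule E)
    from order_ge_cofactors[OF hom less.prems this]
    obtain c where c: "h = (\<Sum>j\<in>UNIV. c j * \<theta> j)" "\<And>j. order_ge w (t + E - \<delta> j) (c j)"
      by blast
    have "c j * \<theta> j \<in> ideal.span (?B t)" for j
    proof -
      have "c j \<in> ideal.span (?B (t - \<delta> j))"
      \<comment> \<open>If \<open>\<delta> j > t\<close>, the bound \<open>t - \<delta> j\<close> truncates to 0 and the span is the whole ring.\<close>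
      proof (cases "\<delta> j \<le> t")
        case True
        then show ?thesis using pos[of j] c(2)[of j] by (intro less.IH) auto
      next
        case False
        then show ?thesis using all by simp
      qed
      then show ?thesis
      proof (induction rule: ideal.span_induct_alt)
        case base
        show ?case by (simp add: ideal.span_zero)
      next
        case (step r y z)
        then obtain \<alpha> where y: "y = (\<Prod>j\<in>UNIV. \<theta> j ^ \<alpha> j)" and \<alpha>: "t - \<delta> j \<le> (\<Sum>j\<in>UNIV. \<alpha> j * \<delta> j)"
          by blast
        let ?\<beta> = "\<lambda>i. \<alpha> i + (if i = j then 1 else 0)"
        have "(\<Prod>i\<in>UNIV. \<theta> i ^ (if i = j then 1 else 0)) = (\<Prod>i\<in>UNIV. if i = j then \<theta> i else 1)"
          by (intro prod.cong) auto
        then have "y * \<theta> j = (\<Prod>i\<in>UNIV. \<theta> i ^ ?\<beta> i)"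
          by (simp add: y power_add prod.distrib)
        moreover have "(\<Sum>i\<in>UNIV. ?\<beta> i * \<delta> i) = (\<Sum>i\<in>UNIV. \<alpha> i * \<delta> i) + \<delta> j"
          by (simp add: distrib_right sum.distrib if_distrib[of "\<lambda>x. x * _"] cong: if_cong)
        ultimately have "y * \<theta> j = (\<Prod>i\<in>UNIV. \<theta> i ^ ?\<beta> i) \<and> t \<le> (\<Sum>i\<in>UNIV. ?\<beta> i * \<delta> i)"
          using \<alpha> by linarith
        then have "y * \<theta> j \<in> ?B t" by (intro CollectI exI[of _ ?\<beta>])
        then have "r * (y * \<theta> j) \<in> ideal.span (?B t)"
          by (intro ideal.span_scale[of "y * \<theta> j"] ideal.span_base)
        then have "r * (y * \<theta> j) + z * \<theta> j \<in> ideal.span (?B t)"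
          using step by (intro ideal.span_add)
        then show ?case by (simp only: distrib_right mult.assoc)
      qed
    qed
    then show ?thesis unfolding c(1) by (intro ideal.span_sum)
  qed
qed

text \<open>A common power of all variables lies in the ideal, and every monomial of large degree is
  divisible by one of these powers.\<close>

lemma exists_order_bound:
  fixes \<theta> :: "'i::finite \<Rightarrow> ('n::finite, 'k::comm_ring_1) mpoly"
  assumes rad: "max_ideal \<subseteq> ideal_radical (ideal.span (range \<theta>))"
  shows "\<exists>E. \<forall>h. order_ge w E h \<longrightarrow> h \<in> ideal.span (range \<theta>)"
proof -
  have "\<exists>k. var i ^ k \<in> ideal.span (range \<theta>)" for i :: 'n
  proof -
    have "(var i :: ('n, 'k) mpoly) \<in> max_ideal"
      unfolding max_ideal_def by (intro ideal.span_base rangeI)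
    then show ?thesis using rad by (auto simp: ideal_radical_def)
  qed
  then obtain k where k: "\<And>i :: 'n. var i ^ k i \<in> ideal.span (range \<theta>)" by metis
  define K where "K = (\<Sum>i\<in>UNIV. k i)"
  have K: "var i ^ K \<in> ideal.span (range \<theta>)" for i :: 'n
  proof -
    have "k i \<le> K" by (simp add: K_def member_le_sum)
    then have "var i ^ K = var i ^ (K - k i) * (var i ^ k i :: ('n, 'k) mpoly)"
      by (simp flip: power_add)
    then show ?thesis using ideal.span_scale[OF k] by simp
  qed
  have "max_ideal_frob K \<subseteq> ideal.span (range \<theta>)"
    unfolding max_ideal_frob_def by (rule ideal.span_minimal) (use K in auto)
  moreover have "h \<in> max_ideal_frob K" if "order_ge w (Suc ((K - 1) * (\<Sum>i\<in>UNIV. w i))) h"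
    for h :: "('n, 'k) mpoly"
    using that by (rule max_ideal_frob_of_order) simp
  ultimately show ?thesis by blast
qed

text \<open>The strong vanishing theorem of Hochster and Huneke for a polynomial ring, where tight closure
  is trivial.  For \<open>Q\<close> a large power of \<open>p\<close> the order of \<open>u ^ Q\<close> exceeds \<open>Q\<close> times the sum of the
  \<open>\<delta>\<^sub>j\<close> by at least \<open>E\<close>.  Each product of the \<open>\<theta>\<^sub>j\<close> in its expansion then contains some \<open>\<theta>\<^sub>j\<close> with
  exponent at least \<open>Q\<close>, and flatness of Frobenius takes \<open>Q\<close>-th roots.\<close>

lemma mem_of_large_order:
  fixes \<theta> :: "'i::finite \<Rightarrow> ('n::finite, 'k::{finite,field}) mpoly"
  assumes p: "prime p" and k: "CARD('k) = p"
    and rad: "max_ideal \<subseteq> ideal_radical (ideal.span (range \<theta>))"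
    and hom: "\<And>j. homogeneous w (\<delta> j) (\<theta> j)" and pos: "\<And>j. \<delta> j > 0"
    and u: "order_ge w t u" "(\<Sum>j\<in>UNIV. \<delta> j) < t"
  shows "u \<in> ideal.span (range \<theta>)"
proof -
  obtain E where E: "\<And>h. order_ge w E h \<Longrightarrow> h \<in> ideal.span (range \<theta>)"
    using exists_order_bound[OF rad, of w] by blast
  define D where "D = (\<Sum>j\<in>UNIV. \<delta> j)"
  \<comment> \<open>Any power of \<open>p\<close> above \<open>E\<close> would do.\<close>
  define Q where "Q = p ^ E"
  have "E < 2 ^ E" by simp
  also have "2 ^ E \<le> Q" unfolding Q_def using prime_ge_2_nat[OF p] by (simp add: power_mono)
  finally have QE: "E < Q" .
  have "order_ge w (Q * t) (u ^ Q)" using u(1) by (rule order_ge_power)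
  moreover have "Q * D + E \<le> Q * t"
  proof -
    have "Q * D + E \<le> Q * D + Q" using QE by simp
    also have "\<dots> = Q * Suc D" by simp
    also have "\<dots> \<le> Q * t" using u(2) by (intro mult_left_mono) (auto simp: D_def)
    finally show ?thesis .
  qed
  ultimately have "order_ge w (Q * D + E) (u ^ Q)" by (rule order_ge_mono)
  then have "u ^ Q \<in> ideal.span {(\<Prod>j\<in>UNIV. \<theta> j ^ \<alpha> j) | \<alpha>. Q * D \<le> (\<Sum>j\<in>UNIV. \<alpha> j * \<delta> j)}"
    by (rule order_ge_imp_mem_span_products[OF hom pos, rotated]) (rule E)
  also have "\<dots> \<subseteq> ideal.span (range (\<lambda>j. \<theta> j ^ Q))"
  proof (rule ideal.span_minimal, safe)
    fix \<alpha> assume \<alpha>: "Q * D \<le> (\<Sum>j\<in>UNIV. \<alpha> j * \<delta> j)"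
    have "\<exists>j. Q \<le> \<alpha> j"
    proof (rule ccontr)
      assume "\<nexists>j. Q \<le> \<alpha> j"
      then have "(\<Sum>j\<in>UNIV. \<alpha> j * \<delta> j) < (\<Sum>j\<in>UNIV. Q * \<delta> j)"
        using pos by (intro sum_strict_mono) (auto simp: not_le)
      then show False using \<alpha> by (simp add: D_def sum_distrib_left)
    qed
    then obtain j where j: "Q \<le> \<alpha> j" ..
    have "\<theta> j ^ Q dvd \<theta> j ^ \<alpha> j" using j by (rule le_imp_power_dvd)
    also have "\<dots> dvd (\<Prod>j\<in>UNIV. \<theta> j ^ \<alpha> j)" by (rule dvd_prodI) auto
    finally obtain c where "(\<Prod>j\<in>UNIV. \<theta> j ^ \<alpha> j) = c * \<theta> j ^ Q"
      by (auto simp: dvd_def mult.commute)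
    then show "(\<Prod>j\<in>UNIV. \<theta> j ^ \<alpha> j) \<in> ideal.span (range (\<lambda>j. \<theta> j ^ Q))"
      by (auto intro: ideal.span_scale ideal.span_base)
  qed
  finally show ?thesis
    unfolding Q_def by (simp add: ideal_frobenius_power_iff[OF p k])
qed

section \<open>Derivatives and perturbations\<close>

lemma pdiff_add: "pdiff i (a + b) = pdiff i a + pdiff i b"
  by (rule poly_mapping_eqI) (simp add: lookup_pdiff lookup_add distrib_left)

lemma pdiff_zero [simp]: "pdiff i 0 = 0"
  by (simp add: pdiff_def)

lemma pdiff_single:
  "pdiff i (single m c) = single (m - single i 1) (of_nat (lookup m i) * c)"
  by (simp add: pdiff_def)

lemma pdiff_mult: "pdiff i (a * b) = pdiff i a * b + a * pdiff i b"
proof (induction a rule: poly_mapping_sum_induct)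
  case (single m c)
  show ?case
  proof (induction b rule: poly_mapping_sum_induct)
    case (single n v)
    have left: "single ((m - single i 1) + n) (of_nat (lookup m i) * c * v) =
        single (m + n - single i 1) (of_nat (lookup m i) * c * v)"
    proof (cases "lookup m i = 0")
      case False
      then have "(m - single i 1) + n = m + n - single i 1"
        by (intro poly_mapping_eqI) (auto simp: lookup_add lookup_minus lookup_single when_def)
      then show ?thesis by simp
    qed simp
    have right: "single (m + (n - single i 1)) (c * (of_nat (lookup n i) * v)) =
        single (m + n - single i 1) (c * (of_nat (lookup n i) * v))"
    proof (cases "lookup n i = 0")
      case False
      then have "m + (n - single i 1) = m + n - single i 1"
        by (intro poly_mapping_eqI) (auto simp: lookup_add lookup_minus lookup_single when_def)
      then show ?thesis by simp
    qed simp
    have "of_nat (lookup m i + lookup n i) * (c * v) =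
        of_nat (lookup m i) * c * v + c * (of_nat (lookup n i) * v)"
      by (simp only: of_nat_add distrib_left distrib_right mult_ac)
    then show ?case
      unfolding pdiff_single mult_single left right by (simp only: lookup_add flip: single_add)
  qed (simp_all add: distrib_left pdiff_add)
qed (simp_all add: distrib_right pdiff_add)

lemma pdiff_power_Suc: "pdiff i (f ^ Suc N) = of_nat (Suc N) * (f ^ N * pdiff i f)"
proof (induction N)
  case (Suc N)
  have "pdiff i (f ^ Suc (Suc N)) = pdiff i f * f ^ Suc N + f * pdiff i (f ^ Suc N)"
    by (simp only: power_Suc[of f "Suc N"] pdiff_mult)
  also have "\<dots> = f ^ Suc N * pdiff i f + of_nat (Suc N) * (f ^ Suc N * pdiff i f)"
    unfolding Suc by (simp only: power_Suc mult_ac)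
  also have "\<dots> = of_nat (Suc (Suc N)) * (f ^ Suc N * pdiff i f)"
    by (simp only: of_nat_Suc distrib_right mult_1_left)
  finally show ?case .
qed (simp only: power_0 power_Suc of_nat_Suc of_nat_0 add_0_right mult_1_left mult_1_right)

lemma homogeneous_pdiff:
  assumes "homogeneous w d f"
  shows "homogeneous w (d - w i) (pdiff i f)"
  unfolding homogeneous_iff_wdeg
proof
  fix m assume "m \<in> keys (pdiff i f)"
  then have "of_nat (Suc (lookup m i)) * lookup f (m + single i 1) \<noteq> 0"
    by (simp only: in_keys_iff lookup_pdiff not_False_eq_True)
  then have "m + single i 1 \<in> keys f" by (metis in_keys_iff mult_zero_right)
  then have "wdeg w m + w i = d" using assms by (auto simp: homogeneous_iff_wdeg wdeg_add)
  then show "wdeg w m = d - w i" by simp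
qed

text \<open>The derivatives of \<open>x\<^sub>j ^ q\<close> vanish when \<open>q\<close> is zero in the coefficient ring, so derivations
  preserve the ideal generated by these powers.\<close>

lemma pdiff_mem_max_ideal_frob:
  fixes h :: "('n, 'k::comm_ring_1) mpoly"
  assumes q: "of_nat q = (0 :: 'k)" and h: "h \<in> max_ideal_frob q"
  shows "pdiff i h \<in> max_ideal_frob q"
  unfolding max_ideal_frob_iff
proof
  fix m assume "m \<in> keys (pdiff i h)"
  then have ne: "of_nat (Suc (lookup m i)) * lookup h (m + single i 1) \<noteq> 0"
    by (simp add: in_keys_iff lookup_pdiff)
  then have "m + single i 1 \<in> keys h" by (metis in_keys_iff mult_zero_right)
  then obtain j where j: "q \<le> lookup (m + single i 1) j"
    using h unfolding max_ideal_frob_iff by blast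
  have "Suc (lookup m i) \<noteq> q" using ne q by (metis mult_zero_left)
  with j have "q \<le> lookup m j"
    by (cases "i = j") (auto simp: lookup_add lookup_single when_def)
  then show "\<exists>j. q \<le> lookup m j" ..
qed

text \<open>Monomial duality: a monomial \<open>x\<^sup>a\<close> of \<open>h\<close> outside the ideal divides the socle monomial, all of
  whose exponents are \<open>q - 1\<close>.  The complementary monomial \<open>x\<^sup>b\<close> does not multiply \<open>h\<close> into the ideal
  and therefore has degree at most \<open>D\<close>.\<close>

lemma max_ideal_frob_colon_degree:
  fixes h :: "('n::finite, 'k::comm_ring_1) mpoly"
  assumes hom: "homogeneous w s h" and notin: "h \<notin> max_ideal_frob q"
    and colon: "\<And>b. D < wdeg w b \<Longrightarrow> single b 1 * h \<in> max_ideal_frob q"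
  shows "(q - 1) * (\<Sum>i\<in>UNIV. w i) \<le> s + D"
proof (rule ccontr)
  assume large: "\<not> ?thesis"
  obtain a where a: "a \<in> keys h" "\<And>i. lookup a i < q"
    using notin by (auto simp: max_ideal_frob_iff not_le)
  \<comment> \<open>The exponents of the complement of \<open>x\<^sup>a\<close> in the socle monomial.\<close>
  define b where "b = Abs_poly_mapping (\<lambda>i. q - 1 - lookup a i)"
  have b: "lookup b i = q - 1 - lookup a i" for i by (simp add: b_def)
  have ba: "lookup (b + a) i = q - 1" for i
    using a(2)[of i] by (simp add: lookup_add b)
  have "wdeg w (b + a) = (q - 1) * (\<Sum>i\<in>UNIV. w i)"
    unfolding wdeg_def ba by (metis mult.commute sum_distrib_right)
  then have "D < wdeg w b"
    using large a(1) hom by (auto simp: wdeg_add homogeneous_iff_wdeg)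
  then have "single b 1 * h \<in> max_ideal_frob q" by (rule colon)
  moreover have "b + a \<in> keys (single b 1 * h)"
    using a(1) by (simp add: in_keys_iff lookup_single_mult_add)
  ultimately obtain i where "q \<le> lookup (b + a) i" by (auto simp: max_ideal_frob_iff)
  then show False using a(2)[of i] by (simp add: ba)
qed

text \<open>Each term of the binomial expansion other than \<open>f ^ Suc M\<close> has a factor \<open>g\<close>, and replacing
  further factors \<open>f\<close> by \<open>g\<close> cannot lower the order.\<close>

lemma order_ge_power_perturbation:
  assumes f: "order_ge w d f" and g: "order_ge w G g" and "d \<le> G"
  shows "order_ge w (M * d + G) ((f + g) ^ Suc M - f ^ Suc M)"
proof (induction M)
  case 0
  show ?case using g by simp
next
  case (Suc M)
  have "order_ge w d (f + g)" using f g \<open>d \<le> G\<close> by (blast intro: order_ge_add order_ge_mono)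
  then have "order_ge w (G + Suc M * d) (g * (f + g) ^ Suc M)"
    by (intro order_ge_mult[OF g] order_ge_power)
  then have "order_ge w (Suc M * d + G) (g * (f + g) ^ Suc M)"
    by (rule order_ge_mono) simp
  moreover have "order_ge w (Suc M * d + G) (f * ((f + g) ^ Suc M - f ^ Suc M))"
    using order_ge_mult[OF f Suc] by (rule order_ge_mono) simp
  ultimately have "order_ge w (Suc M * d + G)
      (f * ((f + g) ^ Suc M - f ^ Suc M) + g * (f + g) ^ Suc M)"
    by (intro order_ge_add)
  moreover have "f * (A - B) + g * A = (f + g) * A - f * B" for A B
    by (simp add: algebra_simps)
  ultimately show ?case by (simp only: power_Suc[of _ "Suc M"])
qed

text \<open>The homogeneous polynomial \<open>f ^ N\<close> is the lowest degree part of \<open>(f + g) ^ N\<close>; its monomials are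
  among those of \<open>(f + g) ^ N\<close>.\<close>

lemma initial_form_power_mem_max_ideal_frob:
  fixes f g :: "('n::finite, 'k::comm_ring_1) mpoly"
  assumes f: "homogeneous w d f" and g: "order_ge w G g" and "d < G"
    and mem: "(f + g) ^ N \<in> max_ideal_frob q"
  shows "f ^ N \<in> max_ideal_frob q"
proof (cases N)
  case 0
  then show ?thesis using mem by simp
next
  case (Suc M)
  have r: "order_ge w (M * d + G) ((f + g) ^ N - f ^ N)"
    unfolding Suc using homogeneous_imp_order_ge[OF f] g \<open>d < G\<close>
    by (intro order_ge_power_perturbation) auto
  show ?thesis
    unfolding max_ideal_frob_iff
  proof
    fix m assume m: "m \<in> keys (f ^ N)"
    then have "wdeg w m = N * d"
      using homogeneous_power[OF f] by (auto simp: homogeneous_iff_wdeg)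
    then have "m \<notin> keys ((f + g) ^ N - f ^ N)"
      using r \<open>d < G\<close> by (auto simp: order_ge_def Suc)
    then have "m \<in> keys ((f + g) ^ N)"
      using m by (simp add: in_keys_iff lookup_minus)
    then show "\<exists>i. q \<le> lookup m i" using mem by (auto simp: max_ideal_frob_iff)
  qed
qed

section \<open>Isolated singularities\<close>

text \<open>The derivative for \<open>x\<^sub>j\<close> has degree \<open>d - w j\<close>.  If this were not positive, \<open>x\<^sub>j\<close> would be the only
  variable and the derivative a constant in the ideal of the variables, hence zero; but then no power
  of \<open>x\<^sub>j\<close> lies in the Jacobian ideal.\<close>

lemma weight_less_degree:
  fixes f :: "('n::finite, 'k::field) mpoly"
  assumes wpos: "\<And>i. w i > 0" and f: "homogeneous w d f"
    and rad: "ideal_radical (Jac f) = max_ideal" and d: "(\<Sum>i\<in>UNIV. w i) \<le> d"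
  shows "w j < d"
proof (rule ccontr)
  assume "\<not> w j < d"
  have "(\<Sum>i\<in>UNIV. w i) = w j + (\<Sum>i\<in>UNIV - {j}. w i)"
    by (rule sum.remove) auto
  with d \<open>\<not> w j < d\<close> have "d = w j" and "(\<Sum>i\<in>UNIV - {j}. w i) = 0" by linarith+
  have all: "i = j" for i
  proof (rule ccontr)
    assume "i \<noteq> j"
    then have "w i \<le> (\<Sum>i\<in>UNIV - {j}. w i)" by (intro member_le_sum) auto
    then show False using wpos[of i] \<open>(\<Sum>i\<in>UNIV - {j}. w i) = 0\<close> by simp
  qed
  have "pdiff j f \<in> Jac f" unfolding Jac_def by (intro ideal.span_base rangeI)
  then have "pdiff j f \<in> max_ideal"
    unfolding rad[symmetric] ideal_radical_def by (intro CollectI exI[of _ 1]) simp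
  then have no_const: "\<exists>i. 1 \<le> lookup m i" if "m \<in> keys (pdiff j f)" for m
    using that unfolding max_ideal_eq_frob_1 max_ideal_frob_iff by blast
  have hom0: "homogeneous w 0 (pdiff j f)"
    using homogeneous_pdiff[OF f, of j] \<open>d = w j\<close> by simp
  have "m \<notin> keys (pdiff j f)" for m
  proof
    assume m: "m \<in> keys (pdiff j f)"
    then obtain i where i: "1 \<le> lookup m i" using no_const by blast
    have "w i * lookup m i \<le> wdeg w m" unfolding wdeg_def by (intro member_le_sum) auto
    also have "wdeg w m = 0" using hom0 m by (simp add: homogeneous_iff_wdeg)
    finally show False using i wpos[of i] by simp
  qed
  then have "keys (pdiff j f) = {}" by blast
  then have "pdiff j f = 0" by simp
  then have "range (\<lambda>i. pdiff i f) = {0}" using all by (auto intro: range_eqI) metis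
  then have "Jac f = {0}" by (simp add: Jac_def ideal.span_singleton)
  moreover have "(var j :: ('n, 'k) mpoly) \<in> ideal_radical (Jac f)"
    unfolding rad max_ideal_def by (intro ideal.span_base rangeI)
  ultimately show False
    by (auto simp: ideal_radical_def var_power)
       (metis lookup_single_eq lookup_zero zero_neq_one)
qed

text \<open>The derivatives of \<open>f ^ Suc M\<close> are the multiples \<open>f ^ M \<theta>\<^sub>j\<close> up to the unit \<open>Suc M\<close>, so \<open>f ^ M\<close>
  multiplies the Jacobian ideal, and with it all monomials of degree above the sum of the
  \<open>d - w j\<close>, into the Frobenius power.  Duality turns this into a lower bound for the degree of
  \<open>f ^ M\<close>.\<close>

lemma homogeneous_power_degree_bound:
  fixes f :: "('n::finite, 'k::{finite,field}) mpoly"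
  assumes p: "prime p" and k: "CARD('k) = p"
    and wpos: "\<And>i. w i > 0" and f: "homogeneous w d f"
    and rad: "ideal_radical (Jac f) = max_ideal" and d: "(\<Sum>i\<in>UNIV. w i) \<le> d"
    and q: "p dvd q" and N: "\<not> p dvd Suc M"
    and mem: "f ^ Suc M \<in> max_ideal_frob q" and notin: "f ^ M \<notin> max_ideal_frob q"
  shows "(q - 1) * (\<Sum>i\<in>UNIV. w i) \<le> M * d + (CARD('n) * d - (\<Sum>i\<in>UNIV. w i))"
proof (rule max_ideal_frob_colon_degree[OF homogeneous_power[OF f] notin])
  fix b assume b: "CARD('n) * d - (\<Sum>i\<in>UNIV. w i) < wdeg w b"
  note char = CHAR_eq_prime_CARD[OF p k]
  have wd: "w j < d" for j by (rule weight_less_degree[OF wpos f rad d])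
  have der: "f ^ M * pdiff j f \<in> max_ideal_frob q" for j
  proof -
    have "of_nat q = (0 :: 'k)" using q by (simp add: of_nat_eq_0_iff_char_dvd char)
    then have "of_nat (Suc M) * (f ^ M * pdiff j f) \<in> max_ideal_frob q"
      using pdiff_mem_max_ideal_frob[OF _ mem] by (simp only: pdiff_power_Suc)
    then have "single 0 (inverse c) * (of_nat (Suc M) * (f ^ M * pdiff j f)) \<in> max_ideal_frob q" for c
      unfolding max_ideal_frob_def by (rule ideal.span_scale)
    note scaled = this
    define c :: 'k where "c = of_nat (Suc M)"
    have "c \<noteq> 0"
      using N unfolding c_def of_nat_eq_0_iff_char_dvd char .
    then have inv: "single 0 (inverse c) * single 0 c = (1 :: ('n, 'k) mpoly)"
      by (simp add: mult_single)
    have of_nat: "of_nat (Suc M) = (single 0 c :: ('n, 'k) mpoly)"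
      unfolding c_def by (rule single_of_nat[symmetric])
    show ?thesis
      using scaled[of c] unfolding of_nat mult.assoc[symmetric] inv mult_1_left .
  qed
  have "(\<Sum>j\<in>UNIV. d - w j) = CARD('n) * d - (\<Sum>i\<in>UNIV. w i)"
    using wd by (subst sum_subtractf_nat) (auto intro: less_imp_le)
  with b have "single b 1 \<in> ideal.span (range (\<lambda>j. pdiff j f))"
    using wd rad
    by (intro mem_of_large_order[OF p k, where w = w and \<delta> = "\<lambda>j. d - w j" and t = "wdeg w b"]
          homogeneous_pdiff[OF f]) (auto simp: order_ge_def Jac_def)
  then obtain c where c: "single b 1 = (\<Sum>j\<in>UNIV. c j * pdiff j f)"
    by (auto simp: ideal_span_range_iff)
  have "single b 1 * f ^ M = (\<Sum>j\<in>UNIV. c j * (f ^ M * pdiff j f))"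
    unfolding c sum_distrib_right by (intro sum.cong refl) (simp only: mult_ac)
  also have "\<dots> \<in> max_ideal_frob q"
    unfolding max_ideal_frob_def
    by (rule ideal.span_sum, rule ideal.span_scale, rule der[unfolded max_ideal_frob_def])
  finally show "single b 1 * f ^ M \<in> max_ideal_frob q" .
qed

text \<open>The two assumptions on \<open>G\<close> enter separately: \<open>d < G\<close> makes a single factor \<open>g\<close> the worst case
  in the binomial expansion, and the other one compensates the deficit in the degree bound for
  \<open>f ^ (N - 1)\<close>.\<close>

lemma power_mem_max_ideal_frob_perturbation:
  fixes f g :: "('n::finite, 'k::{finite,field}) mpoly"
  assumes p: "prime p" and k: "CARD('k) = p"
    and wpos: "\<And>i. w i > 0" and f: "homogeneous w d f"
    and rad: "ideal_radical (Jac f) = max_ideal" and d: "(\<Sum>i\<in>UNIV. w i) \<le> d"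
    and g: "order_ge w G g" and G: "d < G" "CARD('n) * d - (\<Sum>i\<in>UNIV. w i) < G"
  shows "f ^ N \<in> max_ideal_frob (p ^ e) \<Longrightarrow> (f + g) ^ N \<in> max_ideal_frob (p ^ e)"
proof (induction e arbitrary: N)
  case 0
  show ?case
  proof (cases "N = 0")
    case False
    have "order_ge w d (f + g)"
      using homogeneous_imp_order_ge[OF f] g G(1) by (intro order_ge_add) (auto intro: order_ge_mono)
    then have "order_ge w (N * d) ((f + g) ^ N)" by (rule order_ge_power)
    moreover have "0 < d" using weight_less_degree[OF wpos f rad d] by (metis not_gr0 not_less0)
    ultimately show ?thesis
      using False by (intro max_ideal_frob_of_order[where w = w and t = "N * d"]) auto
  qed (use 0 in simp)
next
  case (Suc e)
  let ?q = "p ^ Suc e"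
  \<comment> \<open>Leastness gives \<open>f ^ (N0 - 1)\<close> outside the ideal, as the degree bound requires.\<close>
  define N0 where "N0 = (LEAST N. f ^ N \<in> max_ideal_frob ?q)"
  have N0: "f ^ N0 \<in> max_ideal_frob ?q" and "N0 \<le> N"
    and least: "\<And>M. M < N0 \<Longrightarrow> f ^ M \<notin> max_ideal_frob ?q"
    unfolding N0_def using Suc.prems by (auto intro: LeastI Least_le dest: not_less_Least)
  have "(f + g) ^ N0 \<in> max_ideal_frob ?q"
  proof (cases "p dvd N0")
    case True
    then obtain N' where N': "N0 = N' * p" by (metis dvdE mult.commute)
    have "f ^ N' \<in> max_ideal_frob (p ^ e)"
      using N0 by (simp add: N' power_mult max_ideal_frob_power_iff[OF p k])
    then have "(f + g) ^ N' \<in> max_ideal_frob (p ^ e)" by (rule Suc.IH)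
    then show ?thesis
      by (simp add: N' power_mult max_ideal_frob_power_iff[OF p k])
  next
    case False
    then obtain M where M: "N0 = Suc M" by (metis dvd_0_right not0_implies_Suc)
    have "f ^ M \<notin> max_ideal_frob ?q" using least M by simp
    then have "(?q - 1) * (\<Sum>i\<in>UNIV. w i) \<le> M * d + (CARD('n) * d - (\<Sum>i\<in>UNIV. w i))"
      using N0 False unfolding M
      by (intro homogeneous_power_degree_bound[OF p k wpos f rad d]) auto
    also have "\<dots> < M * d + G" using G(2) by simp
    finally have "(f + g) ^ N0 - f ^ N0 \<in> max_ideal_frob ?q"
      unfolding M using homogeneous_imp_order_ge[OF f] g G(1)
      by (intro max_ideal_frob_of_order[OF order_ge_power_perturbation]) auto
    with N0 have "f ^ N0 + ((f + g) ^ N0 - f ^ N0) \<in> max_ideal_frob ?q"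
      unfolding max_ideal_frob_def by (intro ideal.span_add)
    then show ?thesis by simp
  qed
  then have "(f + g) ^ (N - N0) * (f + g) ^ N0 \<in> max_ideal_frob ?q"
    unfolding max_ideal_frob_def by (rule ideal.span_scale)
  then show ?case using \<open>N0 \<le> N\<close> by (simp flip: power_add)
qed

text \<open>The power of the maximal ideal bounds ordinary degrees, which are at most the weighted ones.
  This gives the second bound, and for at least two variables also the first, since then
  \<open>n d - |w| \<ge> 2 d - d\<close>.  For one variable the first bound comes from the weight, which is at
  least 2.\<close>

lemma order_of_perturbation:
  fixes g :: "('n::finite, 'k::comm_ring_1) mpoly"
  assumes wpos: "\<And>i. w i > 0" and wd: "\<And>i. w i < d" and d: "(\<Sum>i\<in>UNIV. w i) \<le> d"
    and w1: "CARD('n) = 1 \<longrightarrow> (\<forall>i. w i \<noteq> 1)"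
    and g: "g \<in> ideal_power max_ideal (CARD('n) * d - (\<Sum>i\<in>UNIV. w i) + 1)"
  shows "order_ge w (max d (CARD('n) * d - (\<Sum>i\<in>UNIV. w i)) + 1) g"
  unfolding order_ge_def
proof
  fix m assume m: "m \<in> keys g"
  let ?K = "CARD('n) * d - (\<Sum>i\<in>UNIV. w i) + 1"
  have K: "?K \<le> wdeg (\<lambda>_. 1) m"
    using order_ge_ideal_power_max_ideal[OF g] m by (simp add: order_ge_def)
  have "wdeg (\<lambda>_. 1) m \<le> wdeg w m"
    unfolding wdeg_def using wpos by (intro sum_mono mult_right_mono) (auto simp: Suc_le_eq)
  with K have Kw: "?K \<le> wdeg w m" by simp
  have "d + 1 \<le> wdeg w m"
  proof (cases "CARD('n) = 1")
    case True
    then obtain j :: 'n where U: "UNIV = {j}" by (metis card_1_singletonE)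
    have K': "d - w j + 1 \<le> lookup m j" using K by (simp add: wdeg_def U True)
    obtain r where r: "d = w j + Suc r" using wd[of j] by (metis less_imp_Suc_add add_Suc_right)
    have w2: "2 \<le> w j" using w1 True wpos[of j] by (metis One_nat_def Suc_leI le_neq_implies_less numeral_2_eq_2)
    have "d + 1 \<le> w j + 2 * Suc r" by (simp add: r)
    also have "\<dots> \<le> w j + w j * Suc r" using w2 by (intro add_left_mono mult_right_mono) auto
    also have "\<dots> = w j * (d - w j + 1)" by (simp add: r)
    also have "\<dots> \<le> wdeg w m"
      unfolding wdeg_def U using mult_le_mono2[OF K', of "w j"] by simp
    finally show ?thesis .
  next
    case False
    then have "2 \<le> CARD('n)" using zero_less_card_finite[where 'a = 'n] by linarith
    then have "2 * d \<le> CARD('n) * d" by (rule mult_right_mono) simp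
    then show ?thesis using Kw d by linarith
  qed
  with Kw show "max d (CARD('n) * d - (\<Sum>i\<in>UNIV. w i)) + 1 \<le> wdeg w m" by simp
qed

theorem theoremE:
  fixes f g :: "('n::finite, 'k::{finite,field}) mpoly"
    and w :: "'n \<Rightarrow> nat" and p d :: nat
  assumes "prime p" and "CARD('k) = p"
    and "\<forall>i. w i > 0"
    and "homogeneous w d f"
    and "ideal_radical (Jac f) = max_ideal"
    and "d \<ge> (\<Sum>i\<in>UNIV. w i)"
    and "CARD('n) = 1 \<longrightarrow> (\<forall>i. w i \<noteq> 1)"
    and "g \<in> ideal_power max_ideal (CARD('n) * d - (\<Sum>i\<in>UNIV. w i) + 1)"
  shows "fpt p f = fpt p (f + g)"
proof -
  let ?G = "max d (CARD('n) * d - (\<Sum>i\<in>UNIV. w i)) + 1"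
  have wpos: "\<And>i. w i > 0" using assms(3) by blast
  have wd: "\<And>i. w i < d" by (rule weight_less_degree[OF wpos assms(4-6)])
  have g: "order_ge w ?G g" by (rule order_of_perturbation[OF wpos wd assms(6-8)])
  have "f ^ N \<in> max_ideal_frob (p ^ e) \<longleftrightarrow> (f + g) ^ N \<in> max_ideal_frob (p ^ e)" for N e
  proof
    assume "f ^ N \<in> max_ideal_frob (p ^ e)"
    then show "(f + g) ^ N \<in> max_ideal_frob (p ^ e)"
      by (rule power_mem_max_ideal_frob_perturbation[OF assms(1,2) wpos assms(4-6) g, rotated 2]) auto
  next
    assume "(f + g) ^ N \<in> max_ideal_frob (p ^ e)"
    then show "f ^ N \<in> max_ideal_frob (p ^ e)"
      by (rule initial_form_power_mem_max_ideal_frob[OF assms(4) g, rotated 1]) auto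
  qed
  then have "\<nu> f (p ^ e) = \<nu> (f + g) (p ^ e)" for e
    by (simp add: \<nu>_def)
  then show ?thesis by (simp add: fpt_def)
qed

end
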